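(* Let $G$ be a quasi-semi-simple group acting continuously (i.e. the map $G\times X\to X$ is continuous) and by isometries on a metric space $X$. Suppose there is no point $x\in X$ fixed by a non-compact normal subgroup of $G$. Then every $G$-orbit is closed in $X$ and every point stabilizer is compact in $G$.
   Context: A locally compact group $G$ is quasi-semi-simple (qss) if there is a closed subgroup $A<G$ such that (i) $G=CAC$ for some compact $C\subset G$; (ii) for every net $(a_\alpha)$ in $A$ converging to infinity there is a subnet $(a_\beta)$ such that $U^{(a_\beta)}_+$ is not precompact and the subgroup generated by $U^{(a_\beta)}_+,U^{(a_\beta)}_-,U^{(a_\beta)}_0$ is dense in $G$, where for a net $(g_\alpha)$: $U^{(g_\alpha)}_+=\{x: g_\alpha^{-1}xg_\alpha\to e\}$, $U^{(g_\alpha)}_-=\{x: g_\alpha xg_\alpha^{-1}\to e\}$, and $U^{(g_\alpha)}_0$ is the set of $x$ such that every subnet of each of the nets $(g_\alpha^{-1}xg_\alpha)$, $(g_\alpha xg_\alpha^{-1})$ admits a converging subnet. *)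

theory Defs
  imports "HOL-Analysis.Analysis"
begin

text \<open>Groups are written additively via the (not necessarily commutative) type
class group_add: the group product g h is g + h, the identity is 0, inverse is uminus.
Conjugation g^{-1} x g is written - g + x + g.\<close>

definition locally_compact_group :: "('g::{group_add,t2_space}) itself \<Rightarrow> bool" where
  "locally_compact_group TYPE('g) \<longleftrightarrow>
     continuous_on UNIV (\<lambda>p::'g \<times> 'g. fst p + snd p) \<and>
     continuous_on UNIV (uminus :: 'g \<Rightarrow> 'g) \<and>
     (\<forall>x::'g. \<exists>U K. open U \<and> compact K \<and> x \<in> U \<and> U \<subseteq> K)"

definition is_subgroup :: "('g::group_add) set \<Rightarrow> bool" where
  "is_subgroup H \<longleftrightarrow> 0 \<in> H \<and> (\<forall>x\<in>H. \<forall>y\<in>H. x + y \<in> H) \<and> (\<forall>x\<in>H. - x \<in> H)"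

definition is_normal_subgroup :: "('g::group_add) set \<Rightarrow> bool" where
  "is_normal_subgroup N \<longleftrightarrow> is_subgroup N \<and> (\<forall>g. \<forall>n\<in>N. g + n + - g \<in> N)"

definition gen_subgroup :: "('g::group_add) set \<Rightarrow> 'g set" where
  "gen_subgroup S = \<Inter>{H. S \<subseteq> H \<and> is_subgroup H}"

text \<open>Nets are represented by filters (the eventuality filter of the net, pushed
forward to the group). A subnet corresponds to a finer proper filter.\<close>

definition U_plus :: "('g::{group_add,topological_space}) filter \<Rightarrow> 'g set" where
  "U_plus F = {x. ((\<lambda>g. - g + x + g) \<longlongrightarrow> 0) F}"

definition U_minus :: "('g::{group_add,topological_space}) filter \<Rightarrow> 'g set" where
  "U_minus F = {x. ((\<lambda>g. g + x + - g) \<longlongrightarrow> 0) F}"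

definition subnets_have_conv_subnets :: "('i \<Rightarrow> 'a::topological_space) \<Rightarrow> 'i filter \<Rightarrow> bool" where
  "subnets_have_conv_subnets f F \<longleftrightarrow>
     (\<forall>F'. F' \<noteq> bot \<and> F' \<le> filtermap f F \<longrightarrow>
        (\<exists>F''. F'' \<noteq> bot \<and> F'' \<le> F' \<and> (\<exists>y. F'' \<le> nhds y)))"

definition U_zero :: "('g::{group_add,topological_space}) filter \<Rightarrow> 'g set" where
  "U_zero F = {x. subnets_have_conv_subnets (\<lambda>g. - g + x + g) F \<and>
                  subnets_have_conv_subnets (\<lambda>g. g + x + - g) F}"

definition quasi_semi_simple :: "('g::{group_add,t2_space}) itself \<Rightarrow> bool" where
  "quasi_semi_simple TYPE('g) \<longleftrightarrow> locally_compact_group TYPE('g) \<and>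
     (\<exists>A::'g set. is_subgroup A \<and> closed A \<and>
        (\<exists>C. compact C \<and> UNIV = {c1 + a + c2 | c1 a c2. c1 \<in> C \<and> a \<in> A \<and> c2 \<in> C}) \<and>
        (\<forall>F::'g filter. F \<noteq> bot \<and> F \<le> principal A \<and>
            (\<forall>K. compact K \<longrightarrow> eventually (\<lambda>a. a \<notin> K) F) \<longrightarrow>
          (\<exists>F'. F' \<noteq> bot \<and> F' \<le> F \<and> \<not> compact (closure (U_plus F')) \<and>
             closure (gen_subgroup (U_plus F' \<union> U_minus F' \<union> U_zero F')) = UNIV)))"

end

theory Submission
  imports Defs
begin

text \<open>If the conclusion fails at some point, then some $g \to \infty$ satisfies $g x \to y$. Writing
$g = c a c'$ and passing to limits of $c, c'$ in the compact set $C$ gives $a \to \infty$ in $A$ with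
$a x_1 \to y_1$, for some $x_1, y_1$. Since $A$ is a group acting by isometries, the quotients
$b = a_\alpha^{-1} a_\beta$ (with $\beta$ much later than $\alpha$) also tend to infinity in $A$, and
$b x_1 \to x_1$, so that $b^{-1} x_1 \to x_1$ as well. By Mautner's argument both $U_+$ and $U_-$ of a
suitable subnet fix $x_1$. As $U_0$ normalizes $U_+$ and $U_-$, the closed subgroup generated by $U_+$
and $U_-$ is normalized by a dense subgroup, hence is normal; it fixes $x_1$ and it is not compact.\<close>

section \<open>Generated subgroups and normalizers\<close>

lemma is_subgroup_gen_subgroup: "is_subgroup (gen_subgroup S)"
  unfolding gen_subgroup_def is_subgroup_def by blast

lemma subset_gen_subgroup: "S \<subseteq> gen_subgroup S"
  unfolding gen_subgroup_def by blast

lemma gen_subgroup_least: "S \<subseteq> H \<Longrightarrow> is_subgroup H \<Longrightarrow> gen_subgroup S \<subseteq> H"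
  unfolding gen_subgroup_def by blast

text \<open>Conjugation by \<open>g\<close> can map \<open>N\<close> onto a proper subset of itself,
  and then conjugation by \<open>- g\<close> leaves \<open>N\<close>; imposing both conditions makes
  the set stable under inverses.\<close>

lemma is_subgroup_normalizer:
  "is_subgroup {g::'g::group_add. \<forall>n\<in>N. g + n + - g \<in> N \<and> - g + n + g \<in> N}" (is "is_subgroup ?M")
  unfolding is_subgroup_def
proof (intro conjI ballI)
  fix g h assume gh: "g \<in> ?M" "h \<in> ?M"
  have "g + h + n + - (g + h) \<in> N \<and> - (g + h) + n + (g + h) \<in> N" if "n \<in> N" for n
  proof -
    have "g + (h + n + - h) + - g \<in> N" "- h + (- g + n + g) + h \<in> N"
      using gh that by blast+
    moreover have "g + (h + n + - h) + - g = g + h + n + - (g + h)"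
      "- h + (- g + n + g) + h = - (g + h) + n + (g + h)"
      by (simp_all only: minus_add add.assoc)
    ultimately show ?thesis by simp
  qed
  then show "g + h \<in> ?M" by simp
qed auto

lemma is_subgroup_preimage_conjugation:
  assumes "is_subgroup (N::'g::group_add set)"
  shows "is_subgroup {n. g + n + - g \<in> N}"
proof -
  have "g + (a + b) + - g = (g + a + - g) + (g + b + - g)" for a b
    by (simp add: add.assoc del: add_uminus_conv_diff)
  moreover have "g + - a + - g = - (g + a + - g)" for a
    by (simp add: add.assoc minus_add del: add_uminus_conv_diff)
  ultimately show ?thesis
    using assms unfolding is_subgroup_def by (auto simp del: add_uminus_conv_diff)
qed

section \<open>Nets as filters: limits through subnets and nets going to infinity\<close>

text \<open>If \<open>h (f i, v i)\<close> kept leaving a neighbourhood of \<open>c\<close>, then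
  along that subnet some further subnet of \<open>f\<close> would converge to a point
  \<open>y\<close>, and continuity of \<open>h\<close> at \<open>(y, w)\<close> would bring the
  values back. The limit does not depend on \<open>y\<close>, so \<open>f\<close> itself need not
  converge.\<close>

lemma tendsto_of_subnets_have_conv_subnets:
  fixes f :: "'i \<Rightarrow> 'a::topological_space" and v :: "'i \<Rightarrow> 'b::topological_space"
    and h :: "'a \<times> 'b \<Rightarrow> 'c::topological_space"
  assumes f: "subnets_have_conv_subnets f F"
    and v: "(v \<longlongrightarrow> w) F"
    and h: "continuous_on UNIV h" "\<And>p. h (p, w) = c"
  shows "((\<lambda>i. h (f i, v i)) \<longlongrightarrow> c) F"
proof (rule topological_tendstoI, rule ccontr)
  fix W assume W: "open W" "c \<in> W" and not_ev: "\<not> (\<forall>\<^sub>F i in F. h (f i, v i) \<in> W)"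
  \<comment> \<open>\<open>F1\<close> is the subnet of indices whose value lies outside
    \<open>W\<close>; it is proper because the values are not eventually in
    \<open>W\<close>.\<close>
  define F1 where "F1 = inf F (principal {i. h (f i, v i) \<notin> W})"
  have F1: "F1 \<noteq> bot" "F1 \<le> F"
    using not_ev unfolding F1_def trivial_limit_def eventually_inf_principal by auto
  have "filtermap f F1 \<noteq> bot" "filtermap f F1 \<le> filtermap f F"
    using F1 by (auto simp: filtermap_bot_iff intro: filtermap_mono)
  then obtain F2 y where F2: "F2 \<noteq> bot" "F2 \<le> filtermap f F1" "F2 \<le> nhds y"
    using f unfolding subnets_have_conv_subnets_def by blast
  have "open (h -` W)" "(y, w) \<in> h -` W"
    using h W by (auto simp: continuous_on_open_vimage)
  then obtain V V' where V: "open V" "open V'" "y \<in> V" "w \<in> V'" "V \<times> V' \<subseteq> h -` W"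
    using open_prod_elim by (metis mem_Sigma_iff)
  have "\<forall>\<^sub>F i in F1. v i \<in> V'"
    using topological_tendstoD[OF v V(2,4)] F1(2) by (rule filter_leD[rotated])
  moreover have "\<forall>\<^sub>F i in F1. h (f i, v i) \<notin> W"
    unfolding F1_def by (simp add: eventually_inf_principal)
  ultimately have "\<forall>\<^sub>F i in F1. f i \<notin> V"
    by eventually_elim (use V(5) in auto)
  then have "\<forall>\<^sub>F p in F2. p \<notin> V"
    using F2(2) by (simp add: le_filter_def eventually_filtermap)
  moreover have "\<forall>\<^sub>F p in F2. p \<in> V"
    using eventually_nhds_in_open[OF V(1,3)] F2(3) by (rule filter_leD[rotated])
  ultimately have "\<forall>\<^sub>F p in F2. False"
    by eventually_elim simp
  then show False
    using F2(1) by (simp add: trivial_limit_def)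
qed

text \<open>The sets of \<open>g\<close> in \<open>A\<close> that avoid \<open>K\<close> and satisfy
  \<open>dist (\<phi> g) y < e\<close> form a filter base: two of them contain the one for the union
  of the compact sets and the smaller radius.\<close>

lemma ex_filter_escaping_compacts:
  fixes \<phi> :: "'g::t2_space \<Rightarrow> 'x::metric_space"
  assumes ex: "\<And>K e. compact K \<Longrightarrow> e > 0 \<Longrightarrow> \<exists>g\<in>A. g \<notin> K \<and> dist (\<phi> g) y < e"
  shows "\<exists>F. F \<noteq> bot \<and> F \<le> principal A \<and> (\<forall>K. compact K \<longrightarrow> (\<forall>\<^sub>F g in F. g \<notin> K)) \<and> (\<phi> \<longlongrightarrow> y) F"
proof -
  define B where "B = {K::'g set. compact K} \<times> {e::real. e > 0}"
  define S where "S = (\<lambda>(K, e). {g\<in>A. g \<notin> K \<and> dist (\<phi> g) y < e})"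
  define F where "F = (INF b\<in>B. principal (S b))"
  have dir: "\<exists>k\<in>B. principal (S k) \<le> inf (principal (S i)) (principal (S j))" if "i \<in> B" "j \<in> B" for i j
    using that
    by (intro bexI[of _ "(fst i \<union> fst j, min (snd i) (snd j))"])
      (auto simp: B_def S_def compact_Un)
  have "B \<noteq> {}" by (auto simp: B_def intro: exI[of _ 1])
  then have ev: "eventually P F \<longleftrightarrow> (\<exists>b\<in>B. \<forall>g\<in>S b. P g)" for P
    unfolding F_def using dir by (subst eventually_INF_base) (auto simp: eventually_principal)
  have "S b \<noteq> {}" if "b \<in> B" for b
    using that ex by (fastforce simp: B_def S_def)
  then have "F \<noteq> bot"
    unfolding trivial_limit_def ev by blast
  moreover have "\<forall>\<^sub>F g in F. g \<in> A"
    unfolding ev by (intro bexI[of _ "({}, 1)"]) (auto simp: B_def S_def)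
  then have "F \<le> principal A"
    by (simp add: le_principal)
  moreover have "\<forall>\<^sub>F g in F. g \<notin> K" if "compact K" for K
    unfolding ev using that by (intro bexI[of _ "(K, 1)"]) (auto simp: B_def S_def)
  moreover have "\<forall>\<^sub>F g in F. dist (\<phi> g) y < e" if "e > 0" for e
    unfolding ev using that by (intro bexI[of _ "({}, e)"]) (auto simp: B_def S_def)
  then have "(\<phi> \<longlongrightarrow> y) F"
    by (simp add: tendsto_iff)
  ultimately show ?thesis by blast
qed

section \<open>Topological groups: \<open>U_zero\<close> normalizes \<open>U_plus\<close> and
  \<open>U_minus\<close>\<close>

locale topological_group =
  fixes group_type :: "'g::{group_add,t2_space} itself"
  assumes cont_plus: "continuous_on UNIV (\<lambda>p::'g \<times> 'g. fst p + snd p)"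
    and cont_uminus: "continuous_on UNIV (uminus :: 'g \<Rightarrow> 'g)"
begin

lemma continuous_on_plus:
  fixes f g :: "'i::topological_space \<Rightarrow> 'g"
  assumes "continuous_on S f" "continuous_on S g"
  shows "continuous_on S (\<lambda>i. f i + g i)"
  using continuous_on_compose2[OF cont_plus continuous_on_Pair[OF assms]] by simp

lemma continuous_on_uminus:
  fixes f :: "'i::topological_space \<Rightarrow> 'g"
  assumes "continuous_on S f"
  shows "continuous_on S (\<lambda>i. - f i)"
  using continuous_on_compose2[OF cont_uminus assms] by simp

lemmas continuous_on_group_op = continuous_on_plus continuous_on_uminus

lemma is_subgroup_closure:
  assumes H: "is_subgroup (H::'g set)"
  shows "is_subgroup (closure H)"
proof -
  have "(\<lambda>p. fst p + snd p) ` closure (H \<times> H) \<subseteq> closure H"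
    using H by (intro image_closure_subset continuous_on_subset[OF cont_plus])
      (auto simp: is_subgroup_def intro: closure_subset[THEN subsetD])
  moreover have "uminus ` closure H \<subseteq> closure H"
    using H by (intro image_closure_subset continuous_on_subset[OF cont_uminus])
      (auto simp: is_subgroup_def intro: closure_subset[THEN subsetD])
  ultimately show ?thesis
    using H closure_subset[of H] unfolding is_subgroup_def closure_Times image_subset_iff by auto
qed

lemma closure_conjugate_subset:
  assumes "\<And>n. n \<in> H \<Longrightarrow> (g::'g) + n + - g \<in> H" "n \<in> closure H"
  shows "g + n + - g \<in> closure H"
proof -
  have "(\<lambda>n. g + n + - g) ` closure H \<subseteq> closure H"
    using assms(1)
    by (intro image_closure_subset continuous_on_group_op continuous_intros)
      (auto intro: closure_subset[THEN subsetD])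
  then show ?thesis using assms(2) by blast
qed

text \<open>Conjugating \<open>x + u + - x\<close> by \<open>g\<close> is the same as conjugating
  \<open>- g + u + g\<close>, which tends to 0, by \<open>- g + x + g\<close>, whose subnets have
  convergent subnets.\<close>

lemma conjugate_in_U_plus:
  assumes x: "(x::'g) \<in> U_zero F" and u: "u \<in> U_plus F"
  shows "x + u + - x \<in> U_plus F" "- x + u + x \<in> U_plus F"
proof -
  have f: "subnets_have_conv_subnets (\<lambda>g. - g + x + g) F"
    and v: "((\<lambda>g. - g + u + g) \<longlongrightarrow> 0) F"
    using x u by (simp_all add: U_zero_def U_plus_def)
  \<comment> \<open>The map sends \<open>(p, 0)\<close> to 0 for every \<open>p\<close>, as the
    subnet criterion requires.\<close>
  have "((\<lambda>g. (\<lambda>p. fst p + snd p + - fst p) (- g + x + g, - g + u + g)) \<longlongrightarrow> 0) F"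
    by (rule tendsto_of_subnets_have_conv_subnets[OF f v])
      (auto simp del: add_uminus_conv_diff intro!: continuous_on_group_op continuous_intros)
  then show "x + u + - x \<in> U_plus F"
    by (simp add: U_plus_def add.assoc minus_add del: add_uminus_conv_diff)
  have "((\<lambda>g. (\<lambda>p. - fst p + snd p + fst p) (- g + x + g, - g + u + g)) \<longlongrightarrow> 0) F"
    by (rule tendsto_of_subnets_have_conv_subnets[OF f v])
      (auto simp del: add_uminus_conv_diff intro!: continuous_on_group_op continuous_intros)
  then show "- x + u + x \<in> U_plus F"
    by (simp add: U_plus_def add.assoc minus_add del: add_uminus_conv_diff)
qed

lemma conjugate_in_U_minus:
  assumes x: "(x::'g) \<in> U_zero F" and u: "u \<in> U_minus F"
  shows "x + u + - x \<in> U_minus F" "- x + u + x \<in> U_minus F"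
proof -
  have f: "subnets_have_conv_subnets (\<lambda>g. g + x + - g) F"
    and v: "((\<lambda>g. g + u + - g) \<longlongrightarrow> 0) F"
    using x u by (simp_all add: U_zero_def U_minus_def)
  have "((\<lambda>g. (\<lambda>p. fst p + snd p + - fst p) (g + x + - g, g + u + - g)) \<longlongrightarrow> 0) F"
    by (rule tendsto_of_subnets_have_conv_subnets[OF f v])
      (auto simp del: add_uminus_conv_diff intro!: continuous_on_group_op continuous_intros)
  then show "x + u + - x \<in> U_minus F"
    by (simp add: U_minus_def add.assoc minus_add del: add_uminus_conv_diff)
  have "((\<lambda>g. (\<lambda>p. - fst p + snd p + fst p) (g + x + - g, g + u + - g)) \<longlongrightarrow> 0) F"
    by (rule tendsto_of_subnets_have_conv_subnets[OF f v])
      (auto simp del: add_uminus_conv_diff intro!: continuous_on_group_op continuous_intros)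
  then show "- x + u + x \<in> U_minus F"
    by (simp add: U_minus_def add.assoc minus_add del: add_uminus_conv_diff)
qed

text \<open>The normalizer of a closed set is a closed subgroup. Here it contains all three
  generating sets, whose generated subgroup is dense, so it is the whole group.\<close>

lemma is_normal_subgroup_closure_U_plus_U_minus:
  fixes F :: "'g filter"
  assumes dense: "closure (gen_subgroup (U_plus F \<union> U_minus F \<union> U_zero F)) = UNIV"
  shows "is_normal_subgroup (closure (gen_subgroup (U_plus F \<union> U_minus F)))"
proof -
  define H where "H = gen_subgroup (U_plus F \<union> U_minus F)"
  define N where "N = closure H"
  define M where "M = {g. \<forall>n\<in>N. g + n + - g \<in> N \<and> - g + n + g \<in> N}"
  have H: "is_subgroup H" "U_plus F \<union> U_minus F \<subseteq> H"
    unfolding H_def by (simp_all add: is_subgroup_gen_subgroup subset_gen_subgroup)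
  have N: "is_subgroup N"
    unfolding N_def using H(1) by (rule is_subgroup_closure)
  have "H \<subseteq> M"
    using N closure_subset[of H] by (auto simp: is_subgroup_def M_def N_def simp del: add_uminus_conv_diff)
  moreover have "U_zero F \<subseteq> M"
  proof
    fix x assume x: "x \<in> U_zero F"
    \<comment> \<open>The elements that conjugation by \<open>g\<close> sends into \<open>H\<close>
      form a subgroup; once it contains the generators it contains \<open>H\<close>, and continuity
      extends this to the closure.\<close>
    have *: "g + n + - g \<in> N"
      if g: "\<And>u. u \<in> U_plus F \<union> U_minus F \<Longrightarrow> g + u + - g \<in> U_plus F \<union> U_minus F"
        and n: "n \<in> N" for g n
    proof -
      have "H \<subseteq> {n. g + n + - g \<in> H}"
        unfolding H_def using g subset_gen_subgroup
        by (intro gen_subgroup_least is_subgroup_preimage_conjugation is_subgroup_gen_subgroup) blast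
      then show ?thesis
        using n unfolding N_def by (intro closure_conjugate_subset) auto
    qed
    have "x + n + - x \<in> N" "- x + n + x \<in> N" if "n \<in> N" for n
      using *[OF _ that, of x] *[OF _ that, of "- x"] conjugate_in_U_plus[OF x] conjugate_in_U_minus[OF x]
      by auto
    then show "x \<in> M" by (simp add: M_def)
  qed
  ultimately have "gen_subgroup (U_plus F \<union> U_minus F \<union> U_zero F) \<subseteq> M"
    using H(2) unfolding M_def
    by (intro gen_subgroup_least is_subgroup_normalizer) auto
  moreover have "closed M"
  proof -
    \<comment> \<open>For fixed \<open>n\<close> the conjugates depend continuously on
      \<open>g\<close>, so \<open>M\<close> is an intersection of preimages of the closed set
      \<open>N\<close>.\<close>
    have "M = (\<Inter>n\<in>N. ((\<lambda>g. g + n + - g) -` N) \<inter> ((\<lambda>g. - g + n + g) -` N))"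
      by (auto simp: M_def)
    moreover have "closed ((\<lambda>g. g + n + - g) -` N)" "closed ((\<lambda>g. - g + n + g) -` N)" for n
      unfolding N_def
      by (intro closed_vimage closed_closure continuous_on_group_op continuous_intros)+
    ultimately show ?thesis by (auto intro!: closed_INT closed_Int)
  qed
  ultimately have "M = UNIV"
    using dense closure_minimal by blast
  then show ?thesis
    using N unfolding is_normal_subgroup_def N_def H_def M_def by blast
qed

end

section \<open>Isometric actions: the Mautner phenomenon and escaping elements\<close>

locale isometric_group_action = topological_group group_type
  for group_type :: "'g::{group_add,t2_space} itself" +
  fixes act :: "'g \<Rightarrow> 'x::metric_space \<Rightarrow> 'x"
  assumes act_0: "act 0 x = x"
    and act_add: "act (g + h) x = act g (act h x)"
    and act_cont: "continuous_on UNIV (\<lambda>p::'g \<times> 'x. act (fst p) (snd p))"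
    and act_isom: "dist (act g x) (act g y) = dist x y"
begin

lemma continuous_on_act: "continuous_on S (\<lambda>g. act g x)"
  using continuous_on_compose2[OF act_cont, of S "\<lambda>g. (g, x)"]
  by (simp add: continuous_intros)

lemma dist_act_left: "dist (act g x) y = dist x (act (- g) y)"
  using act_isom[of "- g" "act g x" y] by (simp add: act_add[symmetric] act_0)

lemma closed_stabilizer: "closed {g. act g x = x}"
  using closed_vimage[OF closed_singleton continuous_on_act, of x x] by (simp add: vimage_def)

lemma is_subgroup_stabilizer: "is_subgroup {g. act g x = x}"
proof -
  have "act (- g) x = x" if "act g x = x" for g
    using act_add[of "- g" g x] that by (simp add: act_0)
  then show ?thesis
    by (simp add: is_subgroup_def act_0 act_add)
qed

text \<open>The distance from \<open>u h x\<close> to \<open>h x\<close> equals, by isometry, that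
  from \<open>- h + u + h\<close> applied to \<open>x\<close> to \<open>x\<close> itself. The first
  tends to \<open>dist (act u y) y\<close>, the second to 0.\<close>

lemma mautner:
  fixes h :: "'i \<Rightarrow> 'g"
  assumes F: "F \<noteq> bot" and hx: "((\<lambda>i. act (h i) x) \<longlongrightarrow> y) F"
    and u: "((\<lambda>i. - h i + u + h i) \<longlongrightarrow> 0) F"
  shows "act u y = y"
proof -
  have "continuous_on UNIV (\<lambda>z. act u z)"
    using continuous_on_compose2[OF act_cont, of UNIV "\<lambda>z. (u, z)"] by (simp add: continuous_intros)
  then have "((\<lambda>i. act u (act (h i) x)) \<longlongrightarrow> act u y) F"
    using hx by (rule continuous_on_tendsto_compose) auto
  then have "((\<lambda>i. dist (act u (act (h i) x)) (act (h i) x)) \<longlongrightarrow> dist (act u y) y) F"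
    using hx by (rule tendsto_dist)
  moreover have "dist (act u (act (h i) x)) (act (h i) x) = dist (act (- h i + u + h i) x) x" for i
    using dist_act_left[of "- h i" "act u (act (h i) x)" x] by (simp add: act_add)
  moreover have "((\<lambda>i. dist (act (- h i + u + h i) x) x) \<longlongrightarrow> dist (act 0 x) x) F"
    by (intro tendsto_dist tendsto_const continuous_on_tendsto_compose[OF continuous_on_act[of UNIV] u]) auto
  ultimately show ?thesis
    using tendsto_unique[OF F] by (fastforce simp: act_0)
qed

lemma U_plus_U_minus_fix:
  assumes F: "F \<noteq> bot" and lim: "((\<lambda>g. act g x) \<longlongrightarrow> x) F"
    and u: "u \<in> U_plus F \<union> U_minus F"
  shows "act u x = x"
  using u
proof
  assume "u \<in> U_plus F"
  then show ?thesis
    using mautner[OF F lim] by (simp add: U_plus_def)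
next
  assume "u \<in> U_minus F"
  \<comment> \<open>Having \<open>x\<close> as both base point and limit matters here:
    \<open>dist (act g x) x = dist x (act (- g) x)\<close>, so the inverses converge too.\<close>
  moreover have "((\<lambda>g. act (- g) x) \<longlongrightarrow> x) F"
    using lim dist_act_left[of _ x x] by (simp add: tendsto_iff dist_commute)
  ultimately show ?thesis
    using mautner[OF F, of "\<lambda>g. - g"] by (simp add: U_minus_def)
qed

text \<open>Both ways of failing yield elements outside every compact set that bring
  \<open>x\<close> near one point: \<open>x\<close> itself if the stabilizer is not compact,
  otherwise a limit point missing from the orbit.\<close>

lemma not_proper_orbit:
  assumes "\<not> (closed (range (\<lambda>g. act g x)) \<and> compact {g. act g x = x})"
  shows "\<exists>y. \<forall>K e. compact K \<longrightarrow> e > 0 \<longrightarrow> (\<exists>g. g \<notin> K \<and> dist (act g x) y < e)"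
proof (cases "compact {g. act g x = x}")
  case False
  have "\<exists>g. g \<notin> K \<and> act g x = x" if "compact K" for K
  proof (rule ccontr)
    assume "\<not> ?thesis"
    then have "K \<inter> {g. act g x = x} = {g. act g x = x}" by auto
    then show False
      using compact_Int_closed[OF that closed_stabilizer, of x] False by simp
  qed
  then show ?thesis by (intro exI[of _ x]) fastforce
next
  case True
  then obtain y where y: "y \<in> closure (range (\<lambda>g. act g x))" "y \<notin> range (\<lambda>g. act g x)"
    using assms closure_subset_eq by blast
  have "\<exists>g. g \<notin> K \<and> dist (act g x) y < e" if K: "compact K" and e: "e > 0" for K e
  proof -
    \<comment> \<open>The image of \<open>K\<close> is compact and misses \<open>y\<close>, so it
      stays at some distance \<open>d\<close> from \<open>y\<close>; any \<open>g\<close> bringing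
      \<open>x\<close> closer than \<open>d\<close> is outside \<open>K\<close>.\<close>
    have "closed ((\<lambda>g. act g x) ` K)"
      using K by (intro compact_imp_closed compact_continuous_image continuous_on_act)
    moreover have "y \<notin> (\<lambda>g. act g x) ` K"
      using y(2) by blast
    ultimately obtain d where d: "d > 0" "\<And>z. dist z y < d \<Longrightarrow> z \<notin> (\<lambda>g. act g x) ` K"
      using open_dist[of "- (\<lambda>g. act g x) ` K"] by (metis Compl_iff open_Compl)
    obtain g where "dist (act g x) y < min d e"
      using y(1) d(1) e unfolding closure_approachable by (metis (no_types, lifting) min_less_iff_conj rangeE)
    then show ?thesis
      using d(2) by auto
  qed
  then show ?thesis by blast
qed

lemma escape_in_Cartan_subgroup:
  assumes C: "compact C" and CAC: "UNIV = {c1 + a + c2 | c1 a c2. c1 \<in> C \<and> a \<in> A \<and> c2 \<in> C}"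
    and ex: "\<And>K e. compact K \<Longrightarrow> e > 0 \<Longrightarrow> \<exists>g. g \<notin> K \<and> dist (act g x) y < e"
  shows "\<exists>x1 y1. \<forall>K e. compact K \<longrightarrow> e > 0 \<longrightarrow> (\<exists>a\<in>A. a \<notin> K \<and> dist (act a x1) y1 < e)"
proof -
  obtain F where F: "F \<noteq> bot" "\<And>K. compact K \<Longrightarrow> \<forall>\<^sub>F g in F. g \<notin> K"
      "((\<lambda>g. act g x) \<longlongrightarrow> y) F"
    using ex_filter_escaping_compacts[of UNIV "\<lambda>g. act g x" y] ex by auto
  have "\<forall>g. \<exists>c1 a c2. g = c1 + a + c2 \<and> c1 \<in> C \<and> a \<in> A \<and> c2 \<in> C"
    using CAC by blast
  then obtain p a q where paq: "\<And>g. g = p g + a g + q g" "\<And>g. p g \<in> C" "\<And>g. a g \<in> A" "\<And>g. q g \<in> C"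
    by metis
  \<comment> \<open>Compactness of \<open>C \<times> C\<close> gives a cluster point
    \<open>(P, Q)\<close> of the outer factors, which replaces the passage to a convergent
    subnet.\<close>
  have "filtermap (\<lambda>g. (p g, q g)) F \<noteq> bot"
    using F(1) by (simp add: filtermap_bot_iff)
  moreover have "\<forall>\<^sub>F r in filtermap (\<lambda>g. (p g, q g)) F. r \<in> C \<times> C"
    using paq by (simp add: eventually_filtermap)
  ultimately obtain P Q where PQ: "inf (nhds (P, Q)) (filtermap (\<lambda>g. (p g, q g)) F) \<noteq> bot"
    using compact_Times[OF C C] unfolding compact_filter by (metis surj_pair)
  \<comment> \<open>Since \<open>p a q x\<close> is near \<open>y\<close> exactly when
    \<open>a q x\<close> is near \<open>- p\<close> applied to \<open>y\<close>, the new points are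
    \<open>act Q x\<close> and \<open>act (- P) y\<close>. The error \<open>e\<close> splits into
    three: replacing \<open>q\<close> by \<open>Q\<close>, replacing \<open>p\<close> by
    \<open>P\<close>, and the distance from \<open>g x\<close> to \<open>y\<close>.\<close>
  have "\<exists>b\<in>A. b \<notin> K \<and> dist (act b (act Q x)) (act (- P) y) < e" if K: "compact K" and e: "e > 0" for K e
  proof -
    define W where "W = {r. dist (act (snd r) x) (act Q x) < e/3} \<inter> {r. dist (act (- fst r) y) (act (- P) y) < e/3}"
    have "open W"
      unfolding W_def
      by (intro open_Int open_Collect_less continuous_on_dist continuous_on_const
          continuous_on_compose2[OF continuous_on_act] continuous_on_group_op continuous_intros) auto
    then have W: "\<forall>\<^sub>F r in nhds (P, Q). r \<in> W"
      using e by (intro eventually_nhds_in_open) (auto simp: W_def)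
    \<comment> \<open>The product set \<open>C + K + C\<close> is compact, so \<open>g\<close>
      eventually leaves it, which forces its middle factor \<open>a g\<close> out of
      \<open>K\<close>.\<close>
    have "compact ((\<lambda>r. fst r + fst (snd r) + snd (snd r)) ` (C \<times> K \<times> C))"
      using C K by (intro compact_continuous_image compact_Times continuous_on_group_op continuous_intros)
    from F(2)[OF this] tendstoD[OF F(3), of "e/3"] e
    have "\<forall>\<^sub>F g in F. g \<notin> (\<lambda>r. fst r + fst (snd r) + snd (snd r)) ` (C \<times> K \<times> C) \<and> dist (act g x) y < e/3"
      by (simp add: eventually_conj)
    then have far: "\<forall>\<^sub>F g in F. a g \<notin> K \<and> dist (act g x) y < e/3"
    proof eventually_elim
      case (elim g)
      have "g \<in> (\<lambda>r. fst r + fst (snd r) + snd (snd r)) ` (C \<times> K \<times> C)" if "a g \<in> K"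
        using that paq by (intro image_eqI[of _ _ "(p g, a g, q g)"]) auto
      then show ?case using elim by blast
    qed
    \<comment> \<open>At a cluster point the pair is only frequently in \<open>W\<close>; this still
      meets the conditions that hold eventually.\<close>
    have "\<exists>g. (p g, q g) \<in> W \<and> a g \<notin> K \<and> dist (act g x) y < e/3"
    proof (rule ccontr)
      assume "\<not> ?thesis"
      with far have "\<forall>\<^sub>F g in F. (p g, q g) \<notin> W"
        by (auto elim: eventually_mono)
      then have "\<forall>\<^sub>F r in filtermap (\<lambda>g. (p g, q g)) F. r \<notin> W"
        by (simp add: eventually_filtermap)
      with W have "\<forall>\<^sub>F r in inf (nhds (P, Q)) (filtermap (\<lambda>g. (p g, q g)) F). False"
        unfolding eventually_inf by blast
      then show False
        using PQ by (simp add: trivial_limit_def)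
    qed
    then obtain g where g: "dist (act (q g) x) (act Q x) < e/3" "dist (act (- p g) y) (act (- P) y) < e/3"
        "a g \<notin> K" "dist (act g x) y < e/3"
      unfolding W_def by auto
    have "dist (act g x) y = dist (act (a g) (act (q g) x)) (act (- p g) y)"
      by (subst paq(1)[of g]) (simp only: act_add dist_act_left[of "p g"])
    moreover have "dist (act (a g) (act Q x)) (act (a g) (act (q g) x)) < e/3"
      using g(1) by (simp add: act_isom dist_commute)
    ultimately have "dist (act (a g) (act Q x)) (act (- P) y) < e"
      using g(2,4) dist_triangle[of "act (a g) (act Q x)" "act (- P) y" "act (a g) (act (q g) x)"]
        dist_triangle[of "act (a g) (act (q g) x)" "act (- P) y" "act (- p g) y"] by linarith
    then show ?thesis using g(3) paq(3) by blast
  qed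
  then show ?thesis by blast
qed

lemma escape_with_return:
  assumes A: "is_subgroup A"
    and ex: "\<And>K e. compact K \<Longrightarrow> e > 0 \<Longrightarrow> \<exists>a\<in>A. a \<notin> K \<and> dist (act a x) y < e"
    and K: "compact K" and e: "e > 0"
  shows "\<exists>b\<in>A. b \<notin> K \<and> dist (act b x) x < e"
proof -
  obtain a where a: "a \<in> A" "dist (act a x) y < e/2"
    using ex[of "{}" "e/2"] e by auto
  \<comment> \<open>With \<open>a\<close> fixed first, choosing \<open>a'\<close> outside the
    translate \<open>a + K\<close> puts \<open>- a + a'\<close> outside \<open>K\<close>, while
    \<open>act a x\<close> and \<open>act a' x\<close> are both within \<open>e/2\<close> of
    \<open>y\<close>.\<close>
  have "compact ((\<lambda>k. a + k) ` K)"
    using K by (intro compact_continuous_image continuous_on_group_op continuous_intros)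
  then obtain a' where a': "a' \<in> A" "a' \<notin> (\<lambda>k. a + k) ` K" "dist (act a' x) y < e/2"
    using ex[of "(\<lambda>k. a + k) ` K" "e/2"] e by auto
  have "- a + a' \<in> A"
    using A a(1) a'(1) by (simp add: is_subgroup_def)
  moreover have "- a + a' \<notin> K"
    using a'(2) by (metis add_minus_cancel image_eqI)
  moreover have "dist (act (- a + a') x) x < e"
    using dist_act_left[of "- a" "act a' x" x] dist_triangle2[of "act a' x" "act a x" y] a(2) a'(3)
    by (simp add: act_add)
  ultimately show ?thesis by blast
qed

end

theorem theorem6p1:
  fixes act :: "'g::{group_add,t2_space} \<Rightarrow> 'x::metric_space \<Rightarrow> 'x"
  assumes qss: "quasi_semi_simple TYPE('g)"
    and act_0: "\<And>x. act 0 x = x"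
    and act_add: "\<And>g h x. act (g + h) x = act g (act h x)"
    and act_cont: "continuous_on UNIV (\<lambda>p::'g \<times> 'x. act (fst p) (snd p))"
    and act_isom: "\<And>g x y. dist (act g x) (act g y) = dist x y"
    and no_fix: "\<not> (\<exists>x N. is_normal_subgroup N \<and> \<not> compact N \<and> (\<forall>n\<in>N. act n x = x))"
  shows "\<forall>x. closed (range (\<lambda>g. act g x)) \<and> compact {g. act g x = x}"
proof (rule ccontr)
  assume "\<not> ?thesis"
  then obtain x where x: "\<not> (closed (range (\<lambda>g. act g x)) \<and> compact {g. act g x = x})"
    by blast
  interpret isometric_group_action "TYPE('g)" act
    using qss by unfold_locales
      (auto simp: quasi_semi_simple_def locally_compact_group_def act_0 act_add act_cont act_isom)
  obtain A C where A: "is_subgroup A" and C: "compact C"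
      "UNIV = {c1 + a + c2 | c1 a c2. c1 \<in> C \<and> a \<in> A \<and> c2 \<in> C}"
    and contr: "\<And>F::'g filter. F \<noteq> bot \<Longrightarrow> F \<le> principal A \<Longrightarrow>
        \<forall>K. compact K \<longrightarrow> eventually (\<lambda>a. a \<notin> K) F \<Longrightarrow>
        \<exists>F'. F' \<noteq> bot \<and> F' \<le> F \<and> \<not> compact (closure (U_plus F')) \<and>
             closure (gen_subgroup (U_plus F' \<union> U_minus F' \<union> U_zero F')) = UNIV"
    using qss unfolding quasi_semi_simple_def
    by (elim conjE exE) (rule that, assumption+, simp)
  obtain y where "\<forall>K e. compact K \<longrightarrow> e > 0 \<longrightarrow> (\<exists>g. g \<notin> K \<and> dist (act g x) y < e)"
    using not_proper_orbit[OF x] by blast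
  then have "\<exists>x1 y1. \<forall>K e. compact K \<longrightarrow> e > 0 \<longrightarrow> (\<exists>a\<in>A. a \<notin> K \<and> dist (act a x1) y1 < e)"
    by (intro escape_in_Cartan_subgroup[OF C, of x y]) simp
  then obtain x1 y1 where
    xy: "\<forall>K e. compact K \<longrightarrow> e > 0 \<longrightarrow> (\<exists>a\<in>A. a \<notin> K \<and> dist (act a x1) y1 < e)"
    by blast
  have "\<exists>b\<in>A. b \<notin> K \<and> dist (act b x1) x1 < e" if "compact K" "e > 0" for K e
    using escape_with_return[OF A _ that] xy by blast
  then obtain F where F: "F \<noteq> bot" "F \<le> principal A"
      "\<forall>K. compact K \<longrightarrow> (\<forall>\<^sub>F g in F. g \<notin> K)" "((\<lambda>g. act g x1) \<longlongrightarrow> x1) F"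
    using ex_filter_escaping_compacts[of A "\<lambda>g. act g x1" x1] by blast
  obtain F' where F': "F' \<noteq> bot" "F' \<le> F" "\<not> compact (closure (U_plus F'))"
      "closure (gen_subgroup (U_plus F' \<union> U_minus F' \<union> U_zero F')) = UNIV"
    using contr[OF F(1-3)] by blast
  define N where "N = closure (gen_subgroup (U_plus F' \<union> U_minus F'))"
  have "is_normal_subgroup N"
    unfolding N_def by (rule is_normal_subgroup_closure_U_plus_U_minus[OF F'(4)])
  moreover have "\<not> compact N"
  \<comment> \<open>\<open>closure (U_plus F')\<close> is a closed subset of \<open>N\<close> and is
    not compact, so \<open>N\<close> cannot be compact.\<close>
  proof
    assume "compact N"
    moreover have "closure (U_plus F') \<subseteq> N"
      unfolding N_def using subset_gen_subgroup[of "U_plus F' \<union> U_minus F'"]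
      by (intro closure_mono) blast
    ultimately have "compact (closure (U_plus F'))"
      using compact_Int_closed[of N "closure (U_plus F')"] by (simp add: Int_absorb1)
    then show False using F'(3) by simp
  qed
  \<comment> \<open>The stabilizer of \<open>x1\<close> is a closed subgroup, so it contains
    \<open>N\<close> as soon as it contains \<open>U_plus F'\<close> and \<open>U_minus F'\<close>;
    the finer filter \<open>F'\<close> inherits the convergence to \<open>x1\<close>.\<close>
  moreover have "N \<subseteq> {g. act g x1 = x1}"
    unfolding N_def
    using U_plus_U_minus_fix[OF F'(1) tendsto_mono[OF F'(2) F(4)]]
    by (intro closure_minimal gen_subgroup_least closed_stabilizer is_subgroup_stabilizer) blast
  ultimately show False using no_fix by blast
qed

end
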